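(* The $12\times5$ configuration $K_0$ (defined in the context) satisfies $(\mathrm{RW3}^+)$. Consequently $z_{\mathrm{RL}}(12,5)=41$.
   Context: **Augmented configurations.** Cells of the $m\times5$ grid are pairs $(r,c)$, $1\le r\le m$, $1\le c\le5$. An augmented configuration consists of a set $E_1$ of cells (one-edges) and a set $E_2$ of unordered pairs of distinct cells (selected two-edges; the two cells are the halves of the two-edge). Each cell contains at most one edge element, i.e. it is a one-edge, or one half of exactly one selected two-edge, or unoccupied (a hole); in particular supports of distinct edge elements are disjoint. The configuration is simple if it satisfies this disjointness and the one-edge graph (the bipartite graph between rows and columns with edge set $E_1$) is $C_4$-free, i.e. there are no distinct rows $r,s$ and distinct columns $c,d$ with all four cells $(r,c),(r,d),(s,c),(s,d)$ in $E_1$. It is limited if $|E_1|=z(m,5)$, where $z(m,5)$ is the ordinary Zarankiewicz number (maximum number of edges of a $C_4$-free bipartite graph with parts of sizes $m$ and $5$); $z(m,5)=m+10$ for $m\ge10$. The edge elements (labels) are the one-edges and the selected two-edges. The cells of an edge element are its representatives. **Certificates.** To each occupied cell $p$ associate a formal unit vector $v_p$, and put $v_p=0$ for unoccupied $p$. For distinct cells $p,q$ let $\delta(p,q)=1$ if $\{p,q\}\in E_2$ and $\delta(p,q)=0$ otherwise. The certified relations are the statements $\langle v_p,v_q\rangle=\text{(value)}$ (symmetric in $p,q$) obtainable in finitely many steps by: - Unit/hole: $\langle v_p,v_p\rangle=1$ for occupied $p$; $\langle v_p,v_q\rangle=0$ if $p$ or $q$ is unoccupied. - Line rule: if $p\ne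 q$ lie in a common row or a common column, then $\langle v_p,v_q\rangle=\delta(p,q)$. - Rectangle rule: for distinct rows and distinct columns forming a genuine $2\times2$ rectangle with diagonals $\{p,q\}$ and $\{r,s\}$, one has $\langle v_p,v_q\rangle+\langle v_r,v_s\rangle=\delta(p,q)+\delta(r,s)$; so if the value of one diagonal is certified, the value of the other one given by this identity is certified. - Complementary-pair rule: if both diagonals of a genuine rectangle are selected two-edges, then both diagonals are certified to have value $1$. - Saturation: if $\langle v_p,v_{p'}\rangle=1$ is certified, then $p$ and $p'$ may be interchanged in any certified relation. Write $p\sim q$ if $\langle v_p,v_q\rangle=1$ is certified and $p\perp_R q$ if $\langle v_p,v_q\rangle=0$ is certified. **$(\mathrm{RW3}^+)$.** A simple configuration satisfies $(\mathrm{RW3}^+)$ if: (1) $p\sim q$ for every $\{p,q\}\in E_2$; (2) distinct selected two-edges remain in distinct equivalence classes of $\sim$; (3) any two distinct edge elements have certified orthogonal representatives (some cell of one and some cell of the other, hence after (1) all of them, satisfy $\perp_R$). **$z_{\mathrm{RL}}$.** $z_{\mathrm{RL}}(m,5)$ is the maximum of $|E_1|+|E_2|$ over all simple limited configurations on the $m\times5$ grid satisfying $(\mathrm{RW3}^+)$. **Seed $K_0$** ($12\times5$). Below $\bullet$ is a one-edge (each $\bullet$ a different one), and the two occurrences of an integer $j$ are the two halves of the selected two-edge $b_j$, $1\le j\le19$: $$\begin{array}{c|ccccc} &1&2&3&4&5\\\hline 1 & \bullet & \bullet & 4 & 3 & 4 \\ 2 & \bullet & 5 & \bullet & 13 & 6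 \\ 3 & \bullet & 13 & 19 & \bullet & 1 \\ 4 & \bullet & 7 & 18 & 7 & \bullet \\ 5 & 2 & \bullet & \bullet & 2 & 1 \\ 6 & 18 & \bullet & 17 & \bullet & 19 \\ 7 & 15 & \bullet & 16 & 17 & \bullet \\ 8 & 12 & 6 & \bullet & \bullet & 5 \\ 9 & 14 & 15 & \bullet & 3 & \bullet \\ 10 & 11 & 8 & 9 & \bullet & \bullet \\ 11 & 10 & 9 & 8 & \bullet & 12 \\ 12 & 10 & 14 & 11 & 16 & \bullet \end{array}$$ *)

theory Defs
  imports Complex_Main "HOL-Library.Disjoint_Sets"
begin

type_synonym cell = "nat \<times> nat"

definition grid :: "nat \<Rightarrow> nat \<Rightarrow> cell set" where
  "grid m n = {1..m} \<times> {1..n}"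

definition C4_free :: "cell set \<Rightarrow> bool" where
  "C4_free E \<longleftrightarrow> \<not> (\<exists>r s c d. r \<noteq> s \<and> c \<noteq> d \<and>
     (r, c) \<in> E \<and> (r, d) \<in> E \<and> (s, c) \<in> E \<and> (s, d) \<in> E)"

text \<open>A bipartite graph with parts of sizes \<open>m\<close> and \<open>n\<close> is identified with its edge set,
  a set of cells of the \<open>m \<times> n\<close> grid.\<close>

definition zarankiewicz :: "nat \<Rightarrow> nat \<Rightarrow> nat" where
  "zarankiewicz m n = Max {card E | E. E \<subseteq> grid m n \<and> C4_free E}"

text \<open>An edge element is identified with its set of representatives: a one-edge with the
  singleton of its cell, a two-edge with the set of its two halves.\<close>

definition edge_elements :: "cell set \<Rightarrow> cell set set \<Rightarrow> cell set set" where
  "edge_elements E1 E2 = (\<lambda>p. {p}) ` E1 \<union> E2"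

definition occupied :: "cell set \<Rightarrow> cell set set \<Rightarrow> cell set" where
  "occupied E1 E2 = \<Union> (edge_elements E1 E2)"

definition simple_config :: "nat \<Rightarrow> nat \<Rightarrow> cell set \<Rightarrow> cell set set \<Rightarrow> bool" where
  "simple_config m n E1 E2 \<longleftrightarrow>
     E1 \<subseteq> grid m n \<and> E2 \<subseteq> {e. e \<subseteq> grid m n \<and> card e = 2} \<and>
     disjoint (edge_elements E1 E2) \<and> C4_free E1"

definition limited :: "nat \<Rightarrow> nat \<Rightarrow> cell set \<Rightarrow> bool" where
  "limited m n E1 \<longleftrightarrow> card E1 = zarankiewicz m n"

definition two_edge_delta :: "cell set set \<Rightarrow> cell \<Rightarrow> cell \<Rightarrow> real" where
  "two_edge_delta E2 p q = (if {p, q} \<in> E2 then 1 else 0)"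

text \<open>\<open>certified m n E1 E2 p q a\<close>: the relation \<open>\<langle>v\<^sub>p, v\<^sub>q\<rangle> = a\<close> is derivable. The vectors are
  formal, so only the triples \<open>(p, q, a)\<close> are represented. The mirror images of \<open>rectangle\<close>
  and \<open>saturation\<close> are instances of the rules below combined with \<open>symmetric\<close>.\<close>

inductive certified ::
    "nat \<Rightarrow> nat \<Rightarrow> cell set \<Rightarrow> cell set set \<Rightarrow> cell \<Rightarrow> cell \<Rightarrow> real \<Rightarrow> bool"
  for m n :: nat and E1 :: "cell set" and E2 :: "cell set set" where
  symmetric: "certified m n E1 E2 p q a \<Longrightarrow> certified m n E1 E2 q p a"
| unit: "\<lbrakk>p \<in> grid m n; p \<in> occupied E1 E2\<rbrakk> \<Longrightarrow> certified m n E1 E2 p p 1"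
| hole: "\<lbrakk>p \<in> grid m n; q \<in> grid m n; p \<notin> occupied E1 E2 \<or> q \<notin> occupied E1 E2\<rbrakk>
    \<Longrightarrow> certified m n E1 E2 p q 0"
| line: "\<lbrakk>p \<in> grid m n; q \<in> grid m n; p \<noteq> q; fst p = fst q \<or> snd p = snd q\<rbrakk>
    \<Longrightarrow> certified m n E1 E2 p q (two_edge_delta E2 p q)"
| rectangle: "\<lbrakk>r \<in> {1..m}; s \<in> {1..m}; c \<in> {1..n}; d \<in> {1..n}; r \<noteq> s; c \<noteq> d;
    certified m n E1 E2 (r, c) (s, d) a\<rbrakk>
    \<Longrightarrow> certified m n E1 E2 (r, d) (s, c)
          (two_edge_delta E2 (r, c) (s, d) + two_edge_delta E2 (r, d) (s, c) - a)"
| complementary_pair: "\<lbrakk>r \<in> {1..m}; s \<in> {1..m}; c \<in> {1..n}; d \<in> {1..n}; r \<noteq> s; c \<noteq> d;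
    {(r, c), (s, d)} \<in> E2; {(r, d), (s, c)} \<in> E2\<rbrakk>
    \<Longrightarrow> certified m n E1 E2 (r, c) (s, d) 1"
| saturation: "\<lbrakk>certified m n E1 E2 p p' 1; certified m n E1 E2 p q a\<rbrakk>
    \<Longrightarrow> certified m n E1 E2 p' q a"

definition sim_rel :: "nat \<Rightarrow> nat \<Rightarrow> cell set \<Rightarrow> cell set set \<Rightarrow> cell rel" where
  "sim_rel m n E1 E2 = {(p, q). certified m n E1 E2 p q 1}"

definition perp_rel :: "nat \<Rightarrow> nat \<Rightarrow> cell set \<Rightarrow> cell set set \<Rightarrow> cell rel" where
  "perp_rel m n E1 E2 = {(p, q). certified m n E1 E2 p q 0}"

text \<open>The equivalence class of a cell \<open>p\<close> is \<open>sim_rel m n E1 E2 `` {p}\<close>.\<close>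

definition rw3_plus :: "nat \<Rightarrow> nat \<Rightarrow> cell set \<Rightarrow> cell set set \<Rightarrow> bool" where
  "rw3_plus m n E1 E2 \<longleftrightarrow>
     (\<forall>p q. {p, q} \<in> E2 \<longrightarrow> (p, q) \<in> sim_rel m n E1 E2) \<and>
     (\<forall>e\<in>E2. \<forall>f\<in>E2. e \<noteq> f \<longrightarrow>
        (\<forall>p\<in>e. \<forall>q\<in>f. sim_rel m n E1 E2 `` {p} \<noteq> sim_rel m n E1 E2 `` {q})) \<and>
     (\<forall>x\<in>edge_elements E1 E2. \<forall>y\<in>edge_elements E1 E2. x \<noteq> y \<longrightarrow>
        (\<exists>p\<in>x. \<exists>q\<in>y. (p, q) \<in> perp_rel m n E1 E2))"

definition z_RL :: "nat \<Rightarrow> nat \<Rightarrow> nat" where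
  "z_RL m n = Max {card E1 + card E2 | E1 E2.
     simple_config m n E1 E2 \<and> limited m n E1 \<and> rw3_plus m n E1 E2}"

text \<open>In the table of the seed, \<open>0\<close> marks a one-edge and the two occurrences of
  \<open>j \<in> {1..19}\<close> are the halves of the two-edge \<open>b\<^sub>j\<close>.\<close>

definition K0_table :: "nat list list" where
  "K0_table =
    [[ 0,  0,  4,  3,  4],
     [ 0,  5,  0, 13,  6],
     [ 0, 13, 19,  0,  1],
     [ 0,  7, 18,  7,  0],
     [ 2,  0,  0,  2,  1],
     [18,  0, 17,  0, 19],
     [15,  0, 16, 17,  0],
     [12,  6,  0,  0,  5],
     [14, 15,  0,  3,  0],
     [11,  8,  9,  0,  0],
     [10,  9,  8,  0, 12],
     [10, 14, 11, 16,  0]]"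

definition K0_entry :: "cell \<Rightarrow> nat" where
  "K0_entry p = K0_table ! (fst p - 1) ! (snd p - 1)"

definition K0_one_edges :: "cell set" where
  "K0_one_edges = {p \<in> grid 12 5. K0_entry p = 0}"

definition K0_two_edges :: "cell set set" where
  "K0_two_edges = {{p \<in> grid 12 5. K0_entry p = j} | j. j \<in> {1..19}}"

end

theory Submission imports Defs begin

text \<open>
  Every certified relation is true in one concrete model: let \<open>v\<^sub>p\<close> be the basis vector indexed by
  the edge element that contains \<open>p\<close>, and \<open>0\<close> if \<open>p\<close> is a hole. The inner product of \<open>p\<close> and \<open>q\<close> is
  then \<open>1\<close> if both lie in one edge element and \<open>0\<close> otherwise (\<open>gram\<close>), and each rule preserves this
  (\<open>certified_eq_gram\<close>). So a derivation never has to keep track of values, and once \<^emph>\<open>some\<close>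
  value is derivable for every pair of cells, all parts of the condition on \<open>K0\<close> hold at once: halves
  of a two-edge get the value \<open>1\<close>, cells of distinct edge elements get \<open>0\<close>, and no two classes can
  merge (\<open>rw3_plus_if_all_determined\<close>).

  Rectangles and saturation turn one determined pair into another: a rectangle exchanges its
  diagonals, and saturation exchanges a cell for a cell already known to carry the same vector.
  Derivability of a pair is therefore a reachability question: starting from the pair, exchange
  diagonals and halves until the two cells lie on a line, where the value is given. For \<open>K0\<close> the
  two-edges \<open>b\<^sub>5, b\<^sub>6, b\<^sub>8, b\<^sub>9\<close> are certified by the complementary-pair rule; using these, all others
  are certified one after the other, in the order of their labels; and when all halves may be
  exchanged, every pair of cells reaches a line. These two finite searches are evaluated by rewriting
  (\<open>K0_merges\<close>, \<open>K0_reaches\<close>).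

  For the value of \<open>z_RL 12 5\<close>, counting the pairs of columns that meet a row in one-edges gives at
  most \<open>12 + 10\<close> one-edges, and \<open>K0\<close> has exactly \<open>22\<close>. The two-edges occupy two cells each of the
  remaining \<open>60 - 22\<close>, so there are at most \<open>19\<close> of them, which \<open>K0\<close> again attains.
\<close>

section \<open>The orthonormal model of the certified relations\<close>

definition gram :: "cell set \<Rightarrow> cell set set \<Rightarrow> cell \<Rightarrow> cell \<Rightarrow> real" where
  "gram E1 E2 p q = (if \<exists>x\<in>edge_elements E1 E2. p \<in> x \<and> q \<in> x then 1 else 0)"

lemma edge_element_unique:
  assumes "simple_config m n E1 E2" "x \<in> edge_elements E1 E2" "y \<in> edge_elements E1 E2"
    "p \<in> x" "p \<in> y"
  shows "x = y"
  using assms unfolding simple_config_def by (meson disjointD disjoint_iff)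

lemma edge_element_nonempty:
  assumes "simple_config m n E1 E2" "x \<in> edge_elements E1 E2"
  shows "x \<noteq> {}"
  using assms by (auto simp: simple_config_def edge_elements_def)

lemma gram_eq_delta:
  assumes "simple_config m n E1 E2" "p \<noteq> q"
  shows "gram E1 E2 p q = two_edge_delta E2 p q"
proof -
  have "x = {p, q} \<and> x \<in> E2" if "x \<in> edge_elements E1 E2" "p \<in> x" "q \<in> x" for x
  proof -
    have "x \<in> E2"
      using that assms(2) by (auto simp: edge_elements_def)
    hence card: "card x = 2"
      using assms(1) by (auto simp: simple_config_def)
    hence "finite x"
      by (simp add: card_ge_0_finite)
    hence "{p, q} = x"
      using card assms(2) that by (intro card_subset_eq) auto
    with \<open>x \<in> E2\<close> show ?thesis by simp
  qed
  thus ?thesis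
    by (auto simp: gram_def two_edge_delta_def edge_elements_def)
qed

lemma gram_saturation:
  assumes "simple_config m n E1 E2" "gram E1 E2 p p' = 1"
  shows "gram E1 E2 p' q = gram E1 E2 p q"
proof -
  obtain x where "x \<in> edge_elements E1 E2" "p \<in> x" "p' \<in> x"
    using assms(2) by (auto simp: gram_def split: if_splits)
  thus ?thesis
    using edge_element_unique[OF assms(1)] unfolding gram_def by metis
qed

text \<open>The rectangle rule is compatible with the model because a rectangle consists of distinct cells,
  where the model agrees with \<open>two_edge_delta\<close>; the sum of both sides is then the same.\<close>

lemma certified_eq_gram:
  assumes "certified m n E1 E2 p q a" and simple: "simple_config m n E1 E2"
  shows "a = gram E1 E2 p q"
  using assms(1)
proof induction
  case (symmetric p q a)
  thus ?case by (auto simp: gram_def)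
next
  case (unit p)
  thus ?case by (auto simp: gram_def occupied_def)
next
  case (hole p q)
  thus ?case by (auto simp: gram_def occupied_def)
next
  case (line p q)
  thus ?case by (simp add: gram_eq_delta[OF simple])
next
  case (rectangle r s c d a)
  thus ?case by (simp add: gram_eq_delta[OF simple])
next
  case (complementary_pair r s c d)
  thus ?case by (simp add: gram_eq_delta[OF simple] two_edge_delta_def)
next
  case (saturation p p' q a)
  thus ?case by (simp add: gram_saturation[OF simple])
qed

lemma certified_in_grid:
  assumes "certified m n E1 E2 p q a"
  shows "p \<in> grid m n \<and> q \<in> grid m n"
  using assms by induction (auto simp: grid_def)

definition determined :: "nat \<Rightarrow> nat \<Rightarrow> cell set \<Rightarrow> cell set set \<Rightarrow> cell \<times> cell \<Rightarrow> bool" where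
  "determined m n E1 E2 pq \<longleftrightarrow> (\<exists>a. certified m n E1 E2 (fst pq) (snd pq) a)"

lemma determined_gram:
  assumes "simple_config m n E1 E2" "determined m n E1 E2 (p, q)"
  shows "certified m n E1 E2 p q (gram E1 E2 p q)"
  using assms certified_eq_gram unfolding determined_def by fastforce

text \<open>Distinct two-edges stay in distinct classes by the model alone: a merger would
  certify the value \<open>1\<close> for cells of disjoint edge elements.\<close>

lemma rw3_plus_if_all_determined:
  assumes simple: "simple_config m n E1 E2"
    and all: "\<And>p q. p \<in> grid m n \<Longrightarrow> q \<in> grid m n \<Longrightarrow> determined m n E1 E2 (p, q)"
  shows "rw3_plus m n E1 E2"
proof -
  have elem_grid: "p \<in> grid m n" if "x \<in> edge_elements E1 E2" "p \<in> x" for x p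
    using simple that by (auto simp: simple_config_def edge_elements_def)
  have cert: "certified m n E1 E2 p q (gram E1 E2 p q)"
    if "x \<in> edge_elements E1 E2" "y \<in> edge_elements E1 E2" "p \<in> x" "q \<in> y" for x y p q
    using determined_gram[OF simple all] elem_grid that by blast
  have one: "gram E1 E2 p q = 1"
    if "x \<in> edge_elements E1 E2" "p \<in> x" "q \<in> x" for x p q
    using that by (auto simp: gram_def)
  have zero: "gram E1 E2 p q = 0"
    if "x \<in> edge_elements E1 E2" "y \<in> edge_elements E1 E2" "x \<noteq> y" "p \<in> x" "q \<in> y" for x y p q
    using that edge_element_unique[OF simple] unfolding gram_def by metis
  have E2: "e \<in> edge_elements E1 E2" if "e \<in> E2" for e
    using that by (simp add: edge_elements_def)
  have "(p, q) \<in> sim_rel m n E1 E2" if "{p, q} \<in> E2" for p q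
    using cert[of "{p, q}" "{p, q}" p q] one[of "{p, q}" p q] E2[OF that]
    by (simp add: sim_rel_def)
  moreover have "sim_rel m n E1 E2 `` {p} \<noteq> sim_rel m n E1 E2 `` {q}"
    if "e \<in> E2" "f \<in> E2" "e \<noteq> f" "p \<in> e" "q \<in> f" for e f p q
  proof
    assume eq: "sim_rel m n E1 E2 `` {p} = sim_rel m n E1 E2 `` {q}"
    have "certified m n E1 E2 q q 1"
      using cert[of f f q q] one[of f q q] E2 that by simp
    hence "q \<in> sim_rel m n E1 E2 `` {p}"
      unfolding eq by (simp add: sim_rel_def)
    hence "certified m n E1 E2 p q 1"
      by (simp add: sim_rel_def)
    hence "gram E1 E2 p q = 1"
      using certified_eq_gram[OF _ simple] by metis
    thus False
      using zero[of e f p q] E2 that by simp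
  qed
  moreover have "\<exists>p\<in>x. \<exists>q\<in>y. (p, q) \<in> perp_rel m n E1 E2"
    if xy: "x \<in> edge_elements E1 E2" "y \<in> edge_elements E1 E2" "x \<noteq> y" for x y
  proof -
    obtain p q where pq: "p \<in> x" "q \<in> y"
      using edge_element_nonempty[OF simple] xy by blast
    hence "(p, q) \<in> perp_rel m n E1 E2"
      using cert[OF xy(1,2) pq] zero[OF xy pq] by (simp add: perp_rel_def)
    thus ?thesis
      using pq by blast
  qed
  ultimately show ?thesis
    unfolding rw3_plus_def by blast
qed

section \<open>Searching for derivations\<close>

definition flip :: "cell \<times> cell \<Rightarrow> cell \<times> cell" where
  "flip = (\<lambda>((r, c), (s, d)). ((r, d), (s, c)))"

definition collinear :: "cell \<times> cell \<Rightarrow> bool" where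
  "collinear = (\<lambda>((r, c), (s, d)). r = s \<or> c = d)"

fun partners :: "(cell \<times> cell) list \<Rightarrow> cell \<Rightarrow> cell list" where
  "partners [] p = []"
| "partners ((a, b) # S) p = (if p = a then [b] else if p = b then [a] else []) @ partners S p"

text \<open>A move is an exchange of at least one half followed by an exchange of diagonals. Exchanging
  diagonals twice in a row leads back, so a bare exchange of diagonals is offered only at the start of
  a search. When \<open>h\<close> gives each cell at most one partner, this leaves at most three moves, and at most
  one if one of the two cells has no partner, so that most searches hardly branch.\<close>

definition moves :: "(cell \<Rightarrow> cell list) \<Rightarrow> cell \<times> cell \<Rightarrow> (cell \<times> cell) list" where
  "moves h = (\<lambda>(p, q). let P = h p; Q = h q in
     map flip (map (\<lambda>p'. (p', q)) P @ map (Pair p) Q @ List.product P Q))"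

text \<open>With so few moves it is cheaper to bound the depth than to record the visited pairs.\<close>

fun search :: "(cell \<Rightarrow> cell list) \<Rightarrow> nat \<Rightarrow> (cell \<times> cell) list \<Rightarrow> bool" where
  "search h 0 pqs = False"
| "search h (Suc k) pqs =
     (list_ex collinear pqs \<or> search h k (concat (map (moves h) pqs)))"

text \<open>The longest search is the one that certifies \<open>b\<^sub>1\<^sub>6\<close>, when few other halves may be
  exchanged; twenty levels are enough for it.\<close>

definition reaches_line :: "(cell \<Rightarrow> cell list) \<Rightarrow> cell \<times> cell \<Rightarrow> bool" where
  "reaches_line h pq = search h 20 [pq, flip pq]"

lemma partners_certified:
  assumes "\<And>a b. (a, b) \<in> set S \<Longrightarrow> certified m n E1 E2 a b 1" "p' \<in> set (partners S p)"
  shows "certified m n E1 E2 p' p 1"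
proof -
  have "(p, p') \<in> set S \<or> (p', p) \<in> set S"
    using assms(2) by (induction S p rule: partners.induct) (auto split: if_splits)
  thus ?thesis
    using assms(1) certified.symmetric by blast
qed

lemma determined_if_collinear:
  assumes "pq \<in> grid m n \<times> grid m n" "collinear pq"
  shows "determined m n E1 E2 pq"
proof -
  obtain p q where pq: "pq = (p, q)" by (cases pq)
  have grid: "p \<in> grid m n" "q \<in> grid m n" and line: "fst p = fst q \<or> snd p = snd q"
    using assms by (auto simp: pq collinear_def)
  show ?thesis
  proof (cases "p = q")
    case True
    thus ?thesis
      using grid certified.unit[of p m n E1 E2] certified.hole[of p m n p E1 E2]
      unfolding determined_def pq by (metis fst_conv snd_conv)
  next
    case False
    thus ?thesis
      using certified.line[OF grid False line] by (auto simp: determined_def pq)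
  qed
qed

lemma flip_in_grid: "pq \<in> grid m n \<times> grid m n \<Longrightarrow> flip pq \<in> grid m n \<times> grid m n"
  by (auto simp: flip_def grid_def)

lemma determined_if_flip:
  assumes grid: "pq \<in> grid m n \<times> grid m n" and flip: "determined m n E1 E2 (flip pq)"
  shows "determined m n E1 E2 pq"
proof (cases "collinear pq")
  case True
  thus ?thesis by (rule determined_if_collinear[OF grid])
next
  case False
  obtain r c s d where pq: "pq = ((r, c), (s, d))" by (metis prod.collapse)
  obtain a where "certified m n E1 E2 (r, d) (s, c) a"
    using flip by (auto simp: determined_def flip_def pq)
  with certified.rectangle[of r m s d n c E1 E2 a] grid False show ?thesis
    by (auto simp: determined_def pq grid_def collinear_def)
qed

lemma determined_if_moves:
  assumes h: "\<And>a a'. a' \<in> set (h a) \<Longrightarrow> certified m n E1 E2 a' a 1"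
    and grid: "pq \<in> grid m n \<times> grid m n"
    and pq': "pq' \<in> set (moves h pq)"
  shows "pq' \<in> grid m n \<times> grid m n"
    and "determined m n E1 E2 pq' \<Longrightarrow> determined m n E1 E2 pq"
proof -
  obtain p q where pq: "pq = (p, q)" by (cases pq)
  \<comment> \<open>Relating a cell to itself by saturation requires it to be occupied; hence the disjunctions.\<close>
  obtain p' q' where move: "pq' = flip (p', q')"
    and p': "p' = p \<or> certified m n E1 E2 p' p 1" and q': "q' = q \<or> certified m n E1 E2 q' q 1"
  proof -
    have "pq' \<in> (\<lambda>p'. flip (p', q)) ` set (h p)
        \<union> (\<lambda>q'. flip (p, q')) ` set (h q)
        \<union> flip ` (set (h p) \<times> set (h q))"
      using pq' by (simp add: moves_def pq Let_def image_Un image_image)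
    thus ?thesis
      using that h by blast
  qed
  have grid': "(p', q') \<in> grid m n \<times> grid m n"
    using grid p' q' by (auto simp: pq dest: certified_in_grid)
  thus "pq' \<in> grid m n \<times> grid m n"
    unfolding move by (rule flip_in_grid)
  assume "determined m n E1 E2 pq'"
  hence "determined m n E1 E2 (p', q')"
    using determined_if_flip[OF grid'] move by simp
  then obtain a where "certified m n E1 E2 p' q' a"
    by (auto simp: determined_def)
  hence "certified m n E1 E2 p q' a"
    using p' certified.saturation by blast
  hence "certified m n E1 E2 p q a"
    using q' certified.saturation certified.symmetric by blast
  thus "determined m n E1 E2 pq"
    by (auto simp: determined_def pq)
qed

lemma search_sound:
  assumes "\<And>a a'. a' \<in> set (h a) \<Longrightarrow> certified m n E1 E2 a' a 1"
    and "set pqs \<subseteq> grid m n \<times> grid m n" and "search h k pqs"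
  shows "\<exists>pq\<in>set pqs. determined m n E1 E2 pq"
  using assms
proof (induction h k pqs rule: search.induct)
  case (2 h k pqs)
  show ?case
  proof (cases "list_ex collinear pqs")
    case True
    then obtain pq where "pq \<in> set pqs" "collinear pq"
      by (auto simp: list_ex_iff)
    thus ?thesis
      using determined_if_collinear[of pq m n E1 E2] 2(3) by blast
  next
    case False
    have "set (concat (map (moves h) pqs)) \<subseteq> grid m n \<times> grid m n"
    proof
      fix pq'
      assume "pq' \<in> set (concat (map (moves h) pqs))"
      then obtain pq where "pq \<in> set pqs" "pq' \<in> set (moves h pq)"
        by auto
      thus "pq' \<in> grid m n \<times> grid m n"
        using determined_if_moves(1)[OF 2(2), where pq = pq and pq' = pq'] 2(3) by blast
    qed
    moreover have "search h k (concat (map (moves h) pqs))"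
      using 2(4) False by simp
    ultimately obtain pq' where "pq' \<in> set (concat (map (moves h) pqs))"
      and pq': "determined m n E1 E2 pq'"
      using 2(1)[OF 2(2)] by blast
    then obtain pq where "pq \<in> set pqs" "pq' \<in> set (moves h pq)"
      by auto
    thus ?thesis
      using determined_if_moves(2)[OF 2(2), where pq = pq and pq' = pq'] 2(3) pq' by blast
  qed
qed auto

lemma determined_if_reaches_line:
  assumes "\<And>a a'. a' \<in> set (h a) \<Longrightarrow> certified m n E1 E2 a' a 1"
    and grid: "pq \<in> grid m n \<times> grid m n" and "reaches_line h pq"
  shows "determined m n E1 E2 pq"
proof -
  have start: "set [pq, flip pq] \<subseteq> grid m n \<times> grid m n"
    using grid flip_in_grid[OF grid] by simp
  have "\<exists>pq'\<in>set [pq, flip pq]. determined m n E1 E2 pq'"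
    by (rule search_sound[OF assms(1) start assms(3)[unfolded reaches_line_def]])
  thus ?thesis
    using determined_if_flip[OF grid] by auto
qed

fun merges :: "(cell \<times> cell) list \<Rightarrow> (cell \<times> cell) list \<Rightarrow> bool" where
  "merges S [] = True"
| "merges S (e # es) = (reaches_line (partners S) e \<and> merges (e # S) es)"

text \<open>A search for two halves of one two-edge only shows that some value is certified; the
  model says that this value is \<open>1\<close>, so that the halves may be exchanged from then on.\<close>

lemma merges_sound:
  assumes simple: "simple_config m n E1 E2"
    and "\<And>a b. (a, b) \<in> set S \<Longrightarrow> certified m n E1 E2 a b 1"
    and "\<And>a b. (a, b) \<in> set es \<Longrightarrow> {a, b} \<in> E2"
    and "merges S es" and "(p, q) \<in> set es"
  shows "certified m n E1 E2 p q 1"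
  using assms(2-)
proof (induction S es rule: merges.induct)
  case (2 S e es)
  have reach: "reaches_line (partners S) e" and rest: "merges (e # S) es"
    using "2.prems"(3) by (auto split: if_splits)
  obtain a b where e: "e = (a, b)" by (cases e)
  have ab: "{a, b} \<in> E2" using "2.prems"(2) e by simp
  hence "e \<in> grid m n \<times> grid m n"
    using simple e by (auto simp: simple_config_def)
  hence "determined m n E1 E2 (a, b)"
    using determined_if_reaches_line[OF partners_certified[OF "2.prems"(1)] _ reach] e by simp
  hence "certified m n E1 E2 a b (gram E1 E2 a b)"
    by (rule determined_gram[OF simple])
  moreover have "gram E1 E2 a b = 1"
    using ab by (auto simp: gram_def edge_elements_def)
  ultimately have ab_one: "certified m n E1 E2 a b 1" by simp
  show ?case
  proof (cases "(p, q) = e")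
    case True
    thus ?thesis using ab_one e by simp
  next
    case False
    hence pq: "(p, q) \<in> set es"
      using "2.prems"(4) by simp
    show ?thesis
    proof (rule "2.IH"[OF _ _ rest pq])
      show "certified m n E1 E2 x y 1" if "(x, y) \<in> set (e # S)" for x y
        using that ab_one "2.prems"(1)[of x y] e by auto
      show "{x, y} \<in> E2" if "(x, y) \<in> set es" for x y
        using that "2.prems"(2) by simp
    qed
  qed
qed auto

section \<open>The seed\<close>

definition K0_cells :: "cell list" where
  "K0_cells = List.product [1..<13] [1..<6]"

definition K0_complementary :: "(cell \<times> cell) list" where
  "K0_complementary =
    [((2, 2), (8, 5)), ((2, 5), (8, 2)), ((10, 2), (11, 3)), ((10, 3), (11, 2))]"

text \<open>These are the labels other than \<open>5, 6, 8, 9\<close>, ascending. The order matters, since the search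
  for an entry may exchange only halves of \<open>K0_complementary\<close> and of earlier entries.\<close>

definition K0_further :: "(cell \<times> cell) list" where
  "K0_further =
    [((3, 5), (5, 5)), ((5, 1), (5, 4)), ((1, 4), (9, 4)), ((1, 3), (1, 5)), ((4, 2), (4, 4)),
     ((11, 1), (12, 1)), ((10, 1), (12, 3)), ((8, 1), (11, 5)), ((2, 4), (3, 2)),
     ((9, 1), (12, 2)), ((7, 1), (9, 2)), ((7, 3), (12, 4)), ((6, 3), (7, 4)),
     ((4, 3), (6, 1)), ((3, 3), (6, 5))]"

definition K0_halves :: "(cell \<times> cell) list" where
  "K0_halves = K0_complementary @ K0_further"

lemma set_K0_cells: "set K0_cells = grid 12 5"
  by (auto simp: K0_cells_def grid_def)

lemma K0_one_edges_eq: "K0_one_edges = set (filter (\<lambda>p. K0_entry p = 0) K0_cells)"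
  by (auto simp: K0_one_edges_def set_K0_cells)

lemma K0_label_classes:
  "set (map (\<lambda>j. filter (\<lambda>p. K0_entry p = j) K0_cells) [1..<20]) =
   set (map (\<lambda>(p, q). [p, q]) K0_halves)"
  by code_simp

lemma K0_two_edges_eq: "K0_two_edges = (\<lambda>(p, q). {p, q}) ` set K0_halves"
proof -
  have "{1..19} = set [1..<20]"
    by auto
  hence "K0_two_edges = (\<lambda>j. {p \<in> grid 12 5. K0_entry p = j}) ` set [1..<20]"
    unfolding K0_two_edges_def by blast
  also have "\<dots> = set ` set (map (\<lambda>j. filter (\<lambda>p. K0_entry p = j) K0_cells) [1..<20])"
    by (simp only: set_map set_filter set_K0_cells image_image)
  also have "\<dots> = (\<lambda>pq. set (case pq of (p, q) \<Rightarrow> [p, q])) ` set K0_halves"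
    unfolding K0_label_classes by (simp only: set_map image_image)
  also have "\<dots> = (\<lambda>(p, q). {p, q}) ` set K0_halves"
    by (intro image_cong) auto
  finally show ?thesis .
qed

lemma K0_halves_distinct_in_grid:
  "\<forall>(p, q)\<in>set K0_halves. p \<noteq> q \<and> p \<in> set K0_cells \<and> q \<in> set K0_cells"
  by code_simp

lemma card_K0_one_edges: "card K0_one_edges = 22"
  unfolding K0_one_edges_eq by code_simp

lemma card_K0_two_edges: "card K0_two_edges = 19"
proof -
  have "card (set (map (\<lambda>(p, q). {p, q}) K0_halves)) = 19"
    by code_simp
  thus ?thesis
    by (simp add: K0_two_edges_eq)
qed

lemma K0_no_rectangle:
  "\<forall>p\<in>set (filter (\<lambda>p. K0_entry p = 0) K0_cells).
     \<forall>q\<in>set (filter (\<lambda>p. K0_entry p = 0) K0_cells). fst p \<noteq> fst q \<longrightarrow> snd p \<noteq> snd q \<longrightarrow>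
       K0_entry (fst p, snd q) \<noteq> 0 \<or> K0_entry (fst q, snd p) \<noteq> 0"
  by code_simp

lemma C4_free_K0: "C4_free K0_one_edges"
  unfolding C4_free_def
proof (intro notI, elim exE conjE)
  fix r s c d
  assume "r \<noteq> s" "c \<noteq> d"
    and "(r, c) \<in> K0_one_edges" "(s, d) \<in> K0_one_edges"
    and "(r, d) \<in> K0_one_edges" "(s, c) \<in> K0_one_edges"
  thus False
    using K0_no_rectangle[rule_format, of "(r, c)" "(s, d)"]
    by (simp add: K0_one_edges_eq)
qed

lemma simple_K0: "simple_config 12 5 K0_one_edges K0_two_edges"
  unfolding simple_config_def
proof (intro conjI)
  show "K0_one_edges \<subseteq> grid 12 5"
    by (auto simp: K0_one_edges_def)
  show "K0_two_edges \<subseteq> {e. e \<subseteq> grid 12 5 \<and> card e = 2}"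
    using K0_halves_distinct_in_grid
    by (auto simp: K0_two_edges_eq set_K0_cells card_2_iff simp del: Pair_inject)
  have determined_by_cell:
    "x = (if K0_entry p = 0 then {p} else {q \<in> grid 12 5. K0_entry q = K0_entry p})"
    if "x \<in> edge_elements K0_one_edges K0_two_edges" "p \<in> x" for x p
    using that by (auto simp: edge_elements_def K0_one_edges_def K0_two_edges_def)
  show "disjoint (edge_elements K0_one_edges K0_two_edges)"
  proof (rule disjointI)
    fix x y
    assume "x \<in> edge_elements K0_one_edges K0_two_edges"
      "y \<in> edge_elements K0_one_edges K0_two_edges" "x \<noteq> y"
    thus "x \<inter> y = {}"
      using determined_by_cell by blast
  qed
  show "C4_free K0_one_edges"
    by (rule C4_free_K0)
qed

lemma K0_merges: "merges K0_complementary K0_further"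
  by code_simp

text \<open>\<open>sorted_wrt\<close> quantifies over the pairs of entries of a list in one order only, which
  halves the computation; the other order follows by symmetry.\<close>

lemma K0_reaches: "sorted_wrt (\<lambda>p q. reaches_line (partners K0_halves) (p, q)) K0_cells"
  by code_simp

lemma K0_complementary_certified:
  assumes "(p, q) \<in> set K0_complementary"
  shows "certified 12 5 K0_one_edges K0_two_edges p q 1"
proof -
  have E2: "{a, b} \<in> K0_two_edges" if "(a, b) \<in> set K0_complementary" for a b
    using that by (force simp: K0_two_edges_eq K0_halves_def)
  obtain r c s d where pq: "p = (r, c)" "q = (s, d)"
    by (cases p, cases q)
  have "((r, d), (s, c)) \<in> set K0_complementary \<or> ((s, c), (r, d)) \<in> set K0_complementary"
    using assms by (auto simp: K0_complementary_def pq)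
  hence "{(r, d), (s, c)} \<in> K0_two_edges"
    using E2 insert_commute[of "(r, d)" "(s, c)" "{}"] by metis
  moreover have "r \<in> {1..12}" "s \<in> {1..12}" "c \<in> {1..5}" "d \<in> {1..5}" "r \<noteq> s" "c \<noteq> d"
    using assms by (auto simp: K0_complementary_def pq)
  ultimately show ?thesis
    using E2[OF assms] unfolding pq by (intro certified.complementary_pair)
qed

lemma K0_halves_certified:
  assumes "(p, q) \<in> set K0_halves"
  shows "certified 12 5 K0_one_edges K0_two_edges p q 1"
proof (cases "(p, q) \<in> set K0_complementary")
  case True
  thus ?thesis by (rule K0_complementary_certified)
next
  case False
  hence "(p, q) \<in> set K0_further"
    using assms by (simp add: K0_halves_def)
  moreover have "{a, b} \<in> K0_two_edges" if "(a, b) \<in> set K0_further" for a b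
    using that by (force simp: K0_two_edges_eq K0_halves_def)
  ultimately show ?thesis
    using merges_sound[OF simple_K0 K0_complementary_certified _ K0_merges] by blast
qed

lemma sorted_wrt_cases:
  assumes "sorted_wrt P xs" "x \<in> set xs" "y \<in> set xs"
  shows "x = y \<or> P x y \<or> P y x"
  using assms by (induction xs) auto

lemma rw3_plus_K0: "rw3_plus 12 5 K0_one_edges K0_two_edges"
proof (rule rw3_plus_if_all_determined[OF simple_K0])
  fix p q
  assume grid: "p \<in> grid 12 5" "q \<in> grid 12 5"
  have reach: "determined 12 5 K0_one_edges K0_two_edges (a, b)"
    if "reaches_line (partners K0_halves) (a, b)" "a \<in> grid 12 5" "b \<in> grid 12 5" for a b
    using determined_if_reaches_line[where h = "partners K0_halves"]
      partners_certified[where S = K0_halves] K0_halves_certified that by blast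
  consider "p = q" | "reaches_line (partners K0_halves) (p, q)" | "reaches_line (partners K0_halves) (q, p)"
    using sorted_wrt_cases[OF K0_reaches, unfolded set_K0_cells, OF grid] by blast
  thus "determined 12 5 K0_one_edges K0_two_edges (p, q)"
  proof cases
    case 1
    thus ?thesis
      using grid by (intro determined_if_collinear) (auto simp: collinear_def split: prod.splits)
  next
    case 2
    thus ?thesis using reach grid by blast
  next
    case 3
    hence "determined 12 5 K0_one_edges K0_two_edges (q, p)"
      using reach grid by blast
    thus ?thesis
      unfolding determined_def using certified.symmetric by (metis fst_conv snd_conv)
  qed
qed

section \<open>Counting edges\<close>

lemma finite_grid: "finite (grid m n)"
  by (simp add: grid_def)

text \<open>Two rows share at most one column, so different rows use different pairs of columns, and all
  rows together use at most \<open>n choose 2\<close>. A row with \<open>d\<close> edges uses \<open>d choose 2 \<ge> d - 1\<close> pairs,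
  which gives the bound after summation over the \<open>m\<close> rows.\<close>

lemma card_C4_free_le:
  assumes sub: "E \<subseteq> grid m n" and free: "C4_free E"
  shows "card E \<le> m + (n choose 2)"
proof -
  define row where "row r = {c. (r, c) \<in> E}" for r
  define pairs where "pairs r = {B. B \<subseteq> row r \<and> card B = 2}" for r
  have row_sub: "row r \<subseteq> {1..n}" for r
    using sub by (auto simp: row_def grid_def)
  have fin_row: "finite (row r)" for r
    using row_sub by (rule finite_subset) simp
  have fin_pairs: "finite (pairs r)" for r
    using fin_row[of r] by (auto simp: pairs_def)
  have card_pairs: "card (pairs r) = card (row r) choose 2" for r
    unfolding pairs_def by (rule n_subsets[OF fin_row])
  have disj: "pairs r \<inter> pairs s = {}" if "r \<noteq> s" for r s
  proof (rule ccontr)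
    assume "pairs r \<inter> pairs s \<noteq> {}"
    then obtain B where B: "B \<subseteq> row r" "B \<subseteq> row s" "card B = 2"
      by (auto simp: pairs_def)
    then obtain c d where "B = {c, d}" "c \<noteq> d"
      by (auto simp: card_2_iff)
    with B that free show False
      by (auto simp: C4_free_def row_def)
  qed
  have "(\<Sum>r\<in>{1..m}. card (row r) choose 2) = card (\<Union>r\<in>{1..m}. pairs r)"
    using fin_pairs disj by (subst card_UN_disjoint) (auto simp: card_pairs)
  also have "\<dots> \<le> card {B. B \<subseteq> {1..n} \<and> card B = 2}"
    using row_sub by (intro card_mono) (auto simp: pairs_def)
  also have "\<dots> = n choose 2"
    by (simp add: n_subsets)
  finally have pairs_le: "(\<Sum>r\<in>{1..m}. card (row r) choose 2) \<le> n choose 2" .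
  have degree: "d \<le> 1 + (d choose 2)" for d :: nat
  proof (cases d)
    case (Suc k)
    thus ?thesis by (simp add: numeral_2_eq_2)
  qed simp
  have "E = (SIGMA r:{1..m}. row r)"
    using sub by (auto simp: row_def grid_def)
  hence "card E = (\<Sum>r\<in>{1..m}. card (row r))"
    using fin_row by simp
  also have "\<dots> \<le> (\<Sum>r\<in>{1..m}. 1 + (card (row r) choose 2))"
    by (intro sum_mono degree)
  also have "\<dots> \<le> m + (n choose 2)"
    using pairs_le by (simp only: sum.distrib) simp
  finally show ?thesis .
qed

lemma zarankiewicz_12_5: "zarankiewicz 12 5 = 22"
  unfolding zarankiewicz_def
proof (rule Max_eqI)
  let ?A = "{card E |E. E \<subseteq> grid 12 5 \<and> C4_free E}"
  have bound: "y \<le> 22" if y: "y \<in> ?A" for y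
  proof -
    obtain E where "y = card E" "E \<subseteq> grid 12 5" "C4_free E"
      using y by blast
    hence "y \<le> 12 + (5 choose 2)"
      using card_C4_free_le by blast
    thus ?thesis
      by (simp add: eval_nat_numeral)
  qed
  show "y \<le> 22" if "y \<in> ?A" for y
    using bound that .
  show "finite ?A"
    unfolding finite_nat_set_iff_bounded_le using bound by blast
  have "K0_one_edges \<subseteq> grid 12 5"
    by (auto simp: K0_one_edges_def)
  thus "22 \<in> ?A"
    using card_K0_one_edges[symmetric] C4_free_K0 by blast
qed

text \<open>The left-hand side counts the occupied cells.\<close>

lemma card_occupied_le:
  assumes "simple_config m n E1 E2"
  shows "card E1 + 2 * card E2 \<le> m * n"
proof -
  have E1: "E1 \<subseteq> grid m n" and E2: "\<And>e. e \<in> E2 \<Longrightarrow> e \<subseteq> grid m n \<and> card e = 2"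
    and disj: "disjoint (edge_elements E1 E2)"
    using assms by (auto simp: simple_config_def)
  have fin: "finite e" if "e \<in> E2" for e
    using E2[OF that] finite_grid finite_subset by blast
  have fin_E1: "finite E1" and fin_Union: "finite (\<Union>E2)"
    using E1 E2 finite_subset[OF _ finite_grid] by (blast, meson Sup_least)
  have "card (\<Union>E2) = (\<Sum>e\<in>E2. card e)"
    using disj fin by (intro card_Union_disjoint)
      (auto simp: edge_elements_def pairwise_def disjnt_def disjoint_def)
  also have "\<dots> = 2 * card E2"
    using E2 by simp
  finally have union: "card (\<Union>E2) = 2 * card E2" .
  have "E1 \<inter> \<Union>E2 = {}"
  proof (rule ccontr)
    assume "E1 \<inter> \<Union>E2 \<noteq> {}"
    then obtain p e where p: "p \<in> E1" "p \<in> e" "e \<in> E2" by blast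
    hence "{p} = e"
      using edge_element_unique[OF assms, of "{p}" e p] by (simp add: edge_elements_def)
    thus False using E2[OF p(3)] by auto
  qed
  hence "card E1 + card (\<Union>E2) = card (E1 \<union> \<Union>E2)"
    using fin_E1 fin_Union by (intro card_Un_disjoint[symmetric])
  also have "\<dots> \<le> card (grid m n)"
    using E1 E2 by (intro card_mono finite_grid) auto
  also have "\<dots> = m * n"
    by (simp add: grid_def)
  finally show ?thesis
    by (simp add: union)
qed

lemma z_RL_12_5: "z_RL 12 5 = 41"
  unfolding z_RL_def
proof (rule Max_eqI)
  let ?A = "{card E1 + card E2 |E1 E2.
    simple_config 12 5 E1 E2 \<and> limited 12 5 E1 \<and> rw3_plus 12 5 E1 E2}"
  have bound: "y \<le> 41" if y: "y \<in> ?A" for y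
  proof -
    obtain E1 E2 where "y = card E1 + card E2" "card E1 = 22"
      and simple: "simple_config 12 5 E1 E2"
      using y unfolding limited_def zarankiewicz_12_5 by blast
    thus ?thesis
      using card_occupied_le[OF simple] by simp
  qed
  show "y \<le> 41" if "y \<in> ?A" for y
    using bound that .
  show "finite ?A"
    unfolding finite_nat_set_iff_bounded_le using bound by blast
  have "limited 12 5 K0_one_edges"
    by (simp add: limited_def zarankiewicz_12_5 card_K0_one_edges)
  hence "card K0_one_edges + card K0_two_edges \<in> ?A"
    using simple_K0 rw3_plus_K0 by blast
  thus "41 \<in> ?A"
    by (simp only: card_K0_one_edges card_K0_two_edges) simp
qed

theorem proposition3p1:
  "simple_config 12 5 K0_one_edges K0_two_edges
    \<and> rw3_plus 12 5 K0_one_edges K0_two_edges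
    \<and> z_RL 12 5 = 41"
  by (intro conjI simple_K0 rw3_plus_K0 z_RL_12_5)

end
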